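(* Let $A,B\subseteq\mathbb{Z}$ with $\mathrm{BD}(A)=\alpha>0$ and $\mathrm{BD}(B)=\beta>0$. Then for every infinite $X\subseteq\mathbb{Z}$ and for every $x\in X$, there exists a finite subset $F\subset X$ such that (1) $x\in F$; (2) $|F|\le\left\lfloor\frac{1}{\alpha\beta}\right\rfloor$; (3) $X\lhd_d (A-B)+F$.
   Context: The upper Banach density of $A\subseteq\mathbb{Z}$ is $\mathrm{BD}(A)=\lim_{n\to\infty}\max_{x\in\mathbb{Z}}\frac{|A\cap[x+1,x+n]|}{n}$ (equivalently the infimum over $n\ge1$ of the same quantity). $X\lhd_d Y$ ("$X$ is densely embeddable in $Y$", for $X,Y\subseteq\mathbb{Z}$) means: for every finite $G\subseteq X$, the set $\bigcap_{x\in G}(Y-x)=\{t\in\mathbb{Z}\mid t+G\subseteq Y\}$ has positive upper Banach density. $A-B=\{a-b\mid a\in A,\ b\in B\}$ and $C+F=\{c+f\mid c\in C,\ f\in F\}$. *)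

theory Defs
  imports Complex_Main "HOL-Library.Set_Algebras"
begin

text \<open>For each \<open>n\<close> the maximum below ranges over a finite nonempty set of naturals, although the
  index set is infinite (\<open>finite_interval_counts\<close>), so \<open>Max\<close> is the genuine maximum.\<close>

definition max_interval_count :: "int set \<Rightarrow> nat \<Rightarrow> nat" where
  "max_interval_count A n = Max (range (\<lambda>x::int. card (A \<inter> {x + 1..x + int n})))"

text \<open>The limit always exists and equals the infimum over \<open>n \<ge> 1\<close>; see \<open>BD_tendsto\<close> and
  \<open>BD_eq_Inf\<close>.\<close>

definition BD :: "int set \<Rightarrow> real" where
  "BD A = lim (\<lambda>n. real (max_interval_count A n) / real n)"

definition dense_embeddable :: "int set \<Rightarrow> int set \<Rightarrow> bool"  (infix \<open>\<lhd>\<^sub>d\<close> 50) where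
  "X \<lhd>\<^sub>d Y \<longleftrightarrow> (\<forall>G. finite G \<and> G \<subseteq> X \<longrightarrow> BD {t. \<forall>g\<in>G. t + g \<in> Y} > 0)"

text \<open>The operator \<open>-\<close> on sets is set-theoretic difference, so the set of differences gets its own
  name; \<open>+\<close> on sets is the elementwise sum from \<open>Set_Algebras\<close>.\<close>

definition diff_set :: "int set \<Rightarrow> int set \<Rightarrow> int set" where
  "diff_set A B = {a - b | a b. a \<in> A \<and> b \<in> B}"

lemma interval_count_le: "card (A \<inter> {x + 1..x + int n}) \<le> n"
proof -
  have "card (A \<inter> {x + 1..x + int n}) \<le> card {x + 1..x + int n}"
    by (rule card_mono) auto
  then show ?thesis by simp
qed

lemma finite_interval_counts: "finite (range (\<lambda>x::int. card (A \<inter> {x + 1..x + int n})))"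
  by (rule finite_subset[of _ "{..n}"]) (auto intro: interval_count_le)

lemma max_interval_count_ge: "card (A \<inter> {x + 1..x + int n}) \<le> max_interval_count A n"
  unfolding max_interval_count_def by (rule Max_ge[OF finite_interval_counts]) auto

lemma max_interval_count_attained:
  obtains x where "max_interval_count A n = card (A \<inter> {x + 1..x + int n})"
  using Max_in[OF finite_interval_counts[of A n]] unfolding max_interval_count_def by auto

lemma max_interval_count_le: "max_interval_count A n \<le> n"
  using interval_count_le max_interval_count_attained by metis

lemma max_interval_count_add:
  "max_interval_count A (m + n) \<le> max_interval_count A m + max_interval_count A n"
proof -
  obtain x where x: "max_interval_count A (m + n) = card (A \<inter> {x + 1..x + int (m + n)})"
    by (rule max_interval_count_attained)
  have "A \<inter> {x + 1..x + int (m + n)}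
      = (A \<inter> {x + 1..x + int m}) \<union> (A \<inter> {(x + int m) + 1..(x + int m) + int n})"
    by auto
  then have "max_interval_count A (m + n) \<le> card (A \<inter> {x + 1..x + int m})
      + card (A \<inter> {(x + int m) + 1..(x + int m) + int n})"
    using x card_Un_le by metis
  then show ?thesis
    using max_interval_count_ge[of A x m] max_interval_count_ge[of A "x + int m" n] by linarith
qed

lemma max_interval_count_mult_add: "max_interval_count A (q * k + r) \<le> q * max_interval_count A k + r"
proof (induction q)
  case 0
  then show ?case using max_interval_count_le by simp
next
  case (Suc q)
  have "max_interval_count A (Suc q * k + r)
      \<le> max_interval_count A k + max_interval_count A (q * k + r)"
    using max_interval_count_add[of A k "q * k + r"] by (simp add: add.assoc)
  then show ?case using Suc by simp
qed

lemma interval_density_tendsto_Inf: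
  "(\<lambda>n. real (max_interval_count A n) / real n)
    \<longlonglongrightarrow> (INF n\<in>{1..}. real (max_interval_count A n) / real n)"
proof (rule LIMSEQ_I)
  let ?f = "\<lambda>n. real (max_interval_count A n) / real n"
  let ?L = "INF n\<in>{1..}. ?f n"
  fix e :: real assume e: "0 < e"
  have bdd: "bdd_below (?f ` {1..})" by (rule bdd_belowI[of _ 0]) auto
  have "\<exists>y\<in>?f ` {1..}. y < ?L + e / 2" by (rule cInf_lessD) (use e in auto)
  then obtain k where k: "k \<ge> 1" "?f k < ?L + e / 2" by auto
  define N where "N = nat \<lceil>2 * real k / e\<rceil> + 1"
  have "norm (?f n - ?L) < e" if n: "n \<ge> N" for n
  proof -
    have n1: "n \<ge> 1" using n N_def by simp
    have low: "?L \<le> ?f n" by (rule cINF_lower[OF bdd]) (use n1 in auto)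
    have "2 * real k / e < real n" using n unfolding N_def by linarith
    then have kn: "real k / real n < e / 2" using e n1 by (simp add: field_simps)
    have "max_interval_count A n \<le> (n div k) * max_interval_count A k + n mod k"
      using max_interval_count_mult_add[of A "n div k" k "n mod k"] by simp
    also have "\<dots> \<le> (n div k) * max_interval_count A k + k" using k(1) by simp
    finally have "real (max_interval_count A n)
        \<le> real (n div k) * real (max_interval_count A k) + real k"
      by (metis of_nat_add of_nat_le_iff of_nat_mult)
    also have "real (n div k) * real (max_interval_count A k)
        \<le> (real n / real k) * real (max_interval_count A k)"
      by (rule mult_right_mono) (auto simp: of_nat_div_le_of_nat)
    finally have "real (max_interval_count A n) \<le> real n * ?f k + real k" by simp
    then have "?f n \<le> ?f k + real k / real n" using n1 by (simp add: field_simps)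
    then show ?thesis using kn k(2) low unfolding real_norm_def by linarith
  qed
  then show "\<exists>N. \<forall>n\<ge>N. norm (?f n - ?L) < e" by blast
qed

lemma BD_eq_Inf: "BD A = (INF n\<in>{1..}. real (max_interval_count A n) / real n)"
  unfolding BD_def by (rule limI[OF interval_density_tendsto_Inf])

lemma BD_tendsto: "(\<lambda>n. real (max_interval_count A n) / real n) \<longlonglongrightarrow> BD A"
  using interval_density_tendsto_Inf BD_eq_Inf by simp

end

theory Submission
  imports Defs "HOL-Library.Disjoint_Sets" "HOL-Library.Infinite_Set"
begin

text \<open>
  If \<open>C \<subseteq> B\<close> is finite and \<open>{u. u + C \<subseteq> A}\<close> has positive upper Banach density, then every such
  \<open>u\<close> satisfies \<open>u + (C - C) \<subseteq> A - B\<close>. Hence \<open>A - B\<close> contains a copy of \<open>C - C\<close> at densely many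
  places, and a finite \<open>G\<close> can be handled as soon as \<open>G \<subseteq> (C - C) + F\<close>. Two facts make this work.

  First, \<open>C\<close> can be large (\<open>rich_subset_exists\<close>): a window of length \<open>n\<close> contains at least
  \<open>\<beta> n\<close> points of \<open>B\<close>, and by double counting an average shift of \<open>A\<close> catches a proportion
  \<open>\<alpha>\<close> of them. There are finitely many possible intersections, so one with at least
  \<open>\<alpha> \<beta> n\<close> points is caught by a set of shifts of positive density. This gives \<open>C n\<close> for every \<open>n\<close>.

  Second, one \<open>F\<close> serves infinitely many of the \<open>C n\<close> at once (\<open>covering_by_few_translates\<close>). If
  the translates \<open>C n + f\<close> with \<open>f \<in> F\<close> are pairwise disjoint for infinitely many \<open>n\<close>, they pack
  into intervals of length \<open>n + O(1)\<close>, so \<open>|F| \<le> 1 / (\<alpha> \<beta>)\<close>. When \<open>F\<close> is as large as possible with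
  this property, each \<open>y \<in> X\<close> lies in \<open>(C n - C n) + F\<close> for almost all \<open>n\<close> of the infinite set of
  indices belonging to \<open>F\<close>, since otherwise \<open>y\<close> could be added to \<open>F\<close>. For a finite \<open>G \<subseteq> X\<close> a
  single \<open>n\<close> then works for all of \<open>G\<close>. This \<open>n\<close> depends on \<open>G\<close>, which is harmless: dense
  embeddability tests one finite \<open>G\<close> at a time, and \<open>F\<close> does not change.
\<close>

lemma BD_mono:
  assumes "A \<subseteq> B"
  shows "BD A \<le> BD B"
proof (rule LIMSEQ_le[OF BD_tendsto BD_tendsto], intro exI allI impI)
  fix n :: nat
  obtain x where "max_interval_count A n = card (A \<inter> {x + 1..x + int n})"
    by (rule max_interval_count_attained)
  also have "\<dots> \<le> card (B \<inter> {x + 1..x + int n})"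
    by (rule card_mono) (use assms in auto)
  also have "\<dots> \<le> max_interval_count B n"
    by (rule max_interval_count_ge)
  finally show "real (max_interval_count A n) / real n \<le> real (max_interval_count B n) / real n"
    by (simp add: divide_right_mono)
qed

lemma BD_nonneg: "0 \<le> BD A"
  by (rule LIMSEQ_le_const[OF BD_tendsto], intro exI allI impI) simp

lemma BD_mult_le_max_interval_count: "BD A * real n \<le> real (max_interval_count A n)"
proof (cases "n = 0")
  case False
  have "BD A \<le> real (max_interval_count A n) / real n"
    unfolding BD_eq_Inf by (rule cINF_lower, rule bdd_belowI[of _ 0]) (use False in auto)
  with False show ?thesis by (simp add: field_simps)
qed simp

lemma card_interval_shift_ge:
  fixes A :: "int set"
  shows "card (A \<inter> {x + 1..x + int n}) \<le> card {u \<in> {x + 1..x + int n}. u + s \<in> A} + nat \<bar>s\<bar>"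
proof -
  let ?I = "{x + 1..x + int n}"
  let ?D = "{v \<in> ?I. v - s \<notin> ?I}"
  have fin: "finite {v \<in> ?I. Q v}" for Q by (rule finite_subset[of _ ?I]) auto
  have "A \<inter> ?I \<subseteq> (\<lambda>u. u + s) ` {u \<in> ?I. u + s \<in> A} \<union> ?D"
  proof
    fix v assume "v \<in> A \<inter> ?I"
    then show "v \<in> (\<lambda>u. u + s) ` {u \<in> ?I. u + s \<in> A} \<union> ?D"
      by (cases "v - s \<in> ?I") (auto intro!: image_eqI[of _ _ "v - s"])
  qed
  then have "card (A \<inter> ?I) \<le> card ((\<lambda>u. u + s) ` {u \<in> ?I. u + s \<in> A} \<union> ?D)"
    by (intro card_mono finite_UnI finite_imageI fin)
  also have "\<dots> \<le> card ((\<lambda>u. u + s) ` {u \<in> ?I. u + s \<in> A}) + card ?D"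
    by (rule card_Un_le)
  also have "card ((\<lambda>u. u + s) ` {u \<in> ?I. u + s \<in> A}) = card {u \<in> ?I. u + s \<in> A}"
    by (rule card_image) (simp add: inj_on_def)
  also have "card ?D \<le> nat \<bar>s\<bar>"
  proof -
    have "?D \<subseteq> (if s \<ge> 0 then {x + 1..x + s} else {x + int n + s + 1..x + int n})"
      by auto
    then have "card ?D \<le> card (if s \<ge> 0 then {x + 1..x + s} else {x + int n + s + 1..x + int n})"
      by (intro card_mono) auto
    also have "\<dots> = nat \<bar>s\<bar>" by auto
    finally show ?thesis .
  qed
  finally show ?thesis by simp
qed

text \<open>Summing \<open>|{s \<in> S. u + s \<in> A}|\<close> over a window of shifts \<open>u\<close> on which \<open>A\<close> is dense gives about
  \<open>BD A * |S|\<close> on average. The shifts \<open>u\<close> whose pattern \<open>C = {s \<in> S. u + s \<in> A}\<close> satisfies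
  \<open>BD {u. u + C \<subseteq> A} = 0\<close> contribute nothing in the limit, because there are only finitely many
  patterns. Among the remaining patterns there is therefore one at least as large as the average.\<close>

lemma rich_subset_exists:
  assumes A: "BD A > 0" and S: "finite S"
  obtains C where "C \<subseteq> S" "BD A * real (card S) \<le> real (card C)"
    "BD {u. \<forall>c\<in>C. u + c \<in> A} > 0"
proof -
  define V where "V C = {u. \<forall>c\<in>C. u + c \<in> A}" for C
  define \<G> where "\<G> = {C. C \<subseteq> S \<and> BD (V C) > 0}"
  define \<B> where "\<B> = {C. C \<subseteq> S \<and> BD (V C) = 0}"
  define \<phi> where "\<phi> u = {s \<in> S. u + s \<in> A}" for u
  define K where "K = (\<Sum>s\<in>S. nat \<bar>s\<bar>)"
  have finG: "finite \<G>" and finB: "finite \<B>"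
    using S by (auto simp: \<G>_def \<B>_def intro: finite_subset[of _ "Pow S"])
  have "BD A \<le> BD (V {})" by (rule BD_mono) (simp add: V_def)
  then have "{} \<in> \<G>" using A by (simp add: \<G>_def)
  then obtain C where C: "C \<in> \<G>" and "card C = Max (card ` \<G>)"
    using finG Max_in[of "card ` \<G>"] by fastforce
  then have Cmax: "card D \<le> card C" if "D \<in> \<G>" for D using finG that by simp
  \<comment> \<open>Either the pattern of \<open>u\<close> has positive density, or \<open>u\<close> lies in one of the finitely many null
    sets \<open>V D\<close> and the trivial bound \<open>|S|\<close> is charged to it.\<close>
  have phi_card: "card (\<phi> u) \<le> card C + card S * card {D \<in> \<B>. u \<in> V D}" for u
  proof (cases "\<phi> u \<in> \<G>")
    case True
    then show ?thesis using Cmax by (simp add: trans_le_add1)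
  next
    case False
    then have "\<phi> u \<in> {D \<in> \<B>. u \<in> V D}"
      using BD_nonneg[of "V (\<phi> u)"] by (auto simp: \<G>_def \<B>_def \<phi>_def V_def)
    then have "1 \<le> card {D \<in> \<B>. u \<in> V D}"
      using finB by (simp add: Suc_le_eq card_gt_0_iff) blast
    then have "card S * 1 \<le> card S * card {D \<in> \<B>. u \<in> V D}" by (rule mult_le_mono2)
    moreover have "card (\<phi> u) \<le> card S" using S by (intro card_mono) (auto simp: \<phi>_def)
    ultimately show ?thesis by linarith
  qed
  \<comment> \<open>\<open>K\<close> absorbs the boundary effects of shifting the window by the elements of \<open>S\<close>.\<close>
  have count: "card S * max_interval_count A n
      \<le> card C * n + card S * (\<Sum>D\<in>\<B>. max_interval_count (V D) n) + K" for n
  proof -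
    obtain x where x: "max_interval_count A n = card (A \<inter> {x + 1..x + int n})"
      by (rule max_interval_count_attained)
    let ?I = "{x + 1..x + int n}"
    have "card S * max_interval_count A n = (\<Sum>s\<in>S. card (A \<inter> ?I))" by (simp add: x)
    also have "\<dots> \<le> (\<Sum>s\<in>S. card {u \<in> ?I. u + s \<in> A} + nat \<bar>s\<bar>)"
      by (intro sum_mono card_interval_shift_ge)
    also have "\<dots> = (\<Sum>s\<in>S. card {u \<in> ?I. u + s \<in> A}) + K"
      by (simp add: sum.distrib K_def)
    also have "(\<Sum>s\<in>S. card {u \<in> ?I. u + s \<in> A}) = (\<Sum>u\<in>?I. card (\<phi> u))"
      unfolding \<phi>_def by (rule sum_multicount_gen) (use S in auto)
    also have "\<dots> \<le> (\<Sum>u\<in>?I. card C + card S * card {D \<in> \<B>. u \<in> V D})"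
      by (intro sum_mono phi_card)
    also have "\<dots> = card C * n + card S * (\<Sum>u\<in>?I. card {D \<in> \<B>. u \<in> V D})"
      by (simp add: sum.distrib sum_distrib_left)
    also have "(\<Sum>u\<in>?I. card {D \<in> \<B>. u \<in> V D}) = (\<Sum>D\<in>\<B>. card {u \<in> ?I. u \<in> V D})"
      by (rule sum_multicount_gen) (use finB in auto)
    also have "\<dots> \<le> (\<Sum>D\<in>\<B>. max_interval_count (V D) n)"
    proof (rule sum_mono)
      fix D
      have "{u \<in> ?I. u \<in> V D} = V D \<inter> ?I" by auto
      then show "card {u \<in> ?I. u \<in> V D} \<le> max_interval_count (V D) n"
        using max_interval_count_ge by simp
    qed
    finally show ?thesis by simp
  qed
  have "BD A * real (card S) \<le> real (card C)"
  proof (rule LIMSEQ_le)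
    show "(\<lambda>n::nat. BD A * real (card S)) \<longlonglongrightarrow> BD A * real (card S)" by simp
    have "(\<lambda>n. real (card C) + real (card S) * (\<Sum>D\<in>\<B>. real (max_interval_count (V D) n) / real n)
        + real K / real n) \<longlonglongrightarrow> real (card C) + real (card S) * (\<Sum>D\<in>\<B>. BD (V D)) + 0"
      by (intro tendsto_intros BD_tendsto lim_const_over_n)
    then show "(\<lambda>n. real (card C) + real (card S) * (\<Sum>D\<in>\<B>. real (max_interval_count (V D) n) / real n)
        + real K / real n) \<longlonglongrightarrow> real (card C)"
      by (simp add: \<B>_def)
    show "\<exists>N. \<forall>n\<ge>N. BD A * real (card S) \<le> real (card C)
        + real (card S) * (\<Sum>D\<in>\<B>. real (max_interval_count (V D) n) / real n) + real K / real n"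
    proof (intro exI[of _ 1] allI impI)
      fix n :: nat assume n: "n \<ge> 1"
      have "BD A * real (card S) * real n \<le> real (card S) * real (max_interval_count A n)"
        using mult_left_mono[OF BD_mult_le_max_interval_count[of A n], of "real (card S)"]
        by (simp add: mult_ac)
      also have "\<dots> \<le> real (card C) * real n
          + real (card S) * (\<Sum>D\<in>\<B>. real (max_interval_count (V D) n)) + real K"
        using of_nat_mono[OF count[of n], where ?'a = real] by simp
      finally show "BD A * real (card S) \<le> real (card C)
        + real (card S) * (\<Sum>D\<in>\<B>. real (max_interval_count (V D) n) / real n) + real K / real n"
        using n by (simp add: field_simps flip: sum_divide_distrib)
    qed
  qed
  with C that show thesis by (auto simp: \<G>_def V_def)
qed

text \<open>The translates \<open>C n + f\<close> are packed into an interval of length \<open>n + 2 M\<close>, where \<open>M\<close> bounds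
  \<open>F\<close>. As the indices \<open>n\<close> are unbounded while \<open>M\<close> is fixed, the error \<open>2 M\<close> is negligible.\<close>

lemma card_disjoint_translates_le:
  fixes C :: "nat \<Rightarrow> int set" and \<gamma> :: real
  assumes sub: "\<And>n. C n \<subseteq> {a n + 1..a n + int n}"
    and card: "\<And>n. \<gamma> * real n \<le> real (card (C n))"
    and F: "finite F" and N: "infinite N"
    and disj: "\<And>n. n \<in> N \<Longrightarrow> disjoint_family_on (\<lambda>f. (\<lambda>c. c + f) ` C n) F"
  shows "real (card F) * \<gamma> \<le> 1"
proof (rule ccontr)
  assume "\<not> real (card F) * \<gamma> \<le> 1"
  then have pos: "real (card F) * \<gamma> - 1 > 0" by simp
  define M where "M = (\<Sum>f\<in>F. nat \<bar>f\<bar>)"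
  have M: "\<bar>f\<bar> \<le> int M" if "f \<in> F" for f
    using member_le_sum[OF that, of "\<lambda>f. nat \<bar>f\<bar>"] F by (simp add: M_def del: of_nat_sum)
  obtain m where m: "real m > 2 * real M / (real (card F) * \<gamma> - 1)"
    using reals_Archimedean2 by blast
  obtain n where "n \<in> N" "n > m"
    using N unfolding infinite_nat_iff_unbounded by blast
  with m have n: "n \<in> N" "real n > 2 * real M / (real (card F) * \<gamma> - 1)" by auto
  have fin: "finite (C n)" using sub[of n] by (rule finite_subset) simp
  have "real (card F) * \<gamma> * real n \<le> real (card F) * real (card (C n))"
    using mult_left_mono[OF card[of n], of "real (card F)"] by (simp add: mult_ac)
  also have "\<dots> = real (\<Sum>f\<in>F. card ((\<lambda>c. c + f) ` C n))"
    by (simp add: card_image inj_on_def)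
  also have "(\<Sum>f\<in>F. card ((\<lambda>c. c + f) ` C n)) = card (\<Union>f\<in>F. (\<lambda>c. c + f) ` C n)"
    using card_UN_disjoint[OF F, of "\<lambda>f. (\<lambda>c. c + f) ` C n"] fin disj[OF n(1)]
    by (simp add: disjoint_family_on_def)
  also have "\<dots> \<le> card {a n + 1 - int M..a n + int n + int M}"
  proof (intro card_mono subsetI)
    fix y assume "y \<in> (\<Union>f\<in>F. (\<lambda>c. c + f) ` C n)"
    then obtain f c where f: "f \<in> F" and c: "c \<in> C n" and y: "y = c + f" by auto
    from c sub have "a n + 1 \<le> c" "c \<le> a n + int n" by fastforce+
    with M[OF f] y show "y \<in> {a n + 1 - int M..a n + int n + int M}" by auto
  qed simp
  also have "card {a n + 1 - int M..a n + int n + int M} = n + 2 * M" by simp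
  finally have "(real (card F) * \<gamma> - 1) * real n \<le> 2 * real M" by (simp add: algebra_simps)
  with n(2) pos show False by (simp add: field_simps)
qed

text \<open>The set \<open>F\<close> is maximal among those whose translates of \<open>C n\<close> are pairwise disjoint for
  infinitely many \<open>n\<close>. Letting the infinite index set shrink when a point is added to \<open>F\<close> is what
  turns maximality into a statement about almost all indices in \<open>N\<close>.\<close>

lemma covering_by_few_translates:
  fixes C :: "nat \<Rightarrow> int set" and \<gamma> :: real
  assumes sub: "\<And>n. C n \<subseteq> {a n + 1..a n + int n}"
    and card: "\<And>n. \<gamma> * real n \<le> real (card (C n))"
    and \<gamma>: "\<gamma> > 0" and x: "x \<in> X"
  obtains F N where "finite F" "F \<subseteq> X" "x \<in> F" "real (card F) \<le> 1 / \<gamma>" "infinite N"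
    "\<And>y. y \<in> X \<Longrightarrow> finite {n \<in> N. y \<notin> diff_set (C n) (C n) + F}"
proof -
  define P where "P F \<longleftrightarrow> finite F \<and> F \<subseteq> X \<and> x \<in> F \<and>
    (\<exists>N. infinite N \<and> (\<forall>n\<in>N. disjoint_family_on (\<lambda>f. (\<lambda>c. c + f) ` C n) F))" for F
  have bound: "real (card F) \<le> 1 / \<gamma>" if "P F" for F
    using that card_disjoint_translates_le[OF sub card, of F] \<gamma>
    unfolding P_def by (auto simp: field_simps)
  have "P {x}"
    using x by (auto simp: P_def disjoint_family_on_def intro!: exI[of _ UNIV])
  moreover have "\<forall>F. P F \<longrightarrow> card F < Suc (nat \<lfloor>1 / \<gamma>\<rfloor>)"
    using bound by (simp add: le_nat_floor less_Suc_eq_le)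
  ultimately obtain F where PF: "P F" and max: "\<And>F'. P F' \<Longrightarrow> card F' \<le> card F"
    using ex_has_greatest_nat[of P "{x}" card] by blast
  from PF obtain N where F: "finite F" "F \<subseteq> X" "x \<in> F" and N: "infinite N"
    and disj: "\<And>n. n \<in> N \<Longrightarrow> disjoint_family_on (\<lambda>f. (\<lambda>c. c + f) ` C n) F"
    unfolding P_def by blast
  have cover: "finite {n \<in> N. y \<notin> diff_set (C n) (C n) + F}" if y: "y \<in> X" for y
  proof (rule ccontr)
    let ?N = "{n \<in> N. y \<notin> diff_set (C n) (C n) + F}"
    assume inf: "infinite ?N"
    have mem: "y \<in> diff_set (C n) (C n) + F" if "c \<in> C n" "c' \<in> C n" "f \<in> F" "c + y = c' + f"
      for n c c' f
    proof -
      have "c' - c \<in> diff_set (C n) (C n)" using that unfolding diff_set_def by blast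
      moreover have "y = (c' - c) + f" using that(4) by simp
      ultimately show ?thesis using that(3) by (simp add: set_plus_intro)
    qed
    have "y \<notin> F"
    proof
      assume "y \<in> F"
      \<comment> \<open>For \<open>n > 0\<close> the set \<open>C n\<close> is nonempty, so \<open>0 \<in> C n - C n\<close>.\<close>
      obtain n where n: "n \<in> ?N" "n > 0"
        using inf unfolding infinite_nat_iff_unbounded by blast
      have "C n \<noteq> {}" using card[of n] \<gamma> n(2) by (auto simp: mult_le_0_iff)
      then obtain c where "c \<in> C n" by auto
      with mem \<open>y \<in> F\<close> n show False by blast
    qed
    have "disjoint_family_on (\<lambda>f. (\<lambda>c. c + f) ` C n) (insert y F)" if n: "n \<in> ?N" for n
    proof -
      have "(\<lambda>c. c + y) ` C n \<inter> (\<lambda>c. c + f) ` C n = {}" if "f \<in> F" for f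
        using mem that n by (auto simp: image_iff)
      with disj[of n] n show ?thesis
        using \<open>y \<notin> F\<close> by (auto simp: disjoint_family_on_insert)
    qed
    then have "P (insert y F)" unfolding P_def using F y inf by blast
    from max[OF this] show False using \<open>y \<notin> F\<close> F(1) by simp
  qed
  show thesis using that[OF F bound[OF PF] N cover] .
qed

theorem corollary5p5:
  fixes A B :: "int set" and \<alpha> \<beta> :: real
  assumes "BD A = \<alpha>" and "\<alpha> > 0" and "BD B = \<beta>" and "\<beta> > 0"
  shows "\<forall>X::int set. infinite X \<longrightarrow> (\<forall>x\<in>X. \<exists>F. finite F \<and> F \<subset> X \<and> x \<in> F
           \<and> int (card F) \<le> \<lfloor>1 / (\<alpha> * \<beta>)\<rfloor>
           \<and> X \<lhd>\<^sub>d diff_set A B + F)"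
proof (intro allI impI ballI)
  fix X :: "int set" and x assume X: "infinite X" and x: "x \<in> X"
  define good where "good n a C \<longleftrightarrow> C \<subseteq> B \<inter> {a + 1..a + int n}
      \<and> \<alpha> * \<beta> * real n \<le> real (card C) \<and> BD {u. \<forall>c\<in>C. u + c \<in> A} > 0" for n a C
  have "\<exists>a C. good n a C" for n
  proof -
    obtain a where a: "max_interval_count B n = card (B \<inter> {a + 1..a + int n})"
      by (rule max_interval_count_attained)
    obtain C where C: "C \<subseteq> B \<inter> {a + 1..a + int n}"
      "BD A * real (card (B \<inter> {a + 1..a + int n})) \<le> real (card C)"
      "BD {u. \<forall>c\<in>C. u + c \<in> A} > 0"
      using rich_subset_exists[of A "B \<inter> {a + 1..a + int n}"] assms by auto
    have "\<beta> * real n \<le> real (card (B \<inter> {a + 1..a + int n}))"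
      using BD_mult_le_max_interval_count[of B n] assms(3) a by simp
    then have "\<alpha> * (\<beta> * real n) \<le> \<alpha> * real (card (B \<inter> {a + 1..a + int n}))"
      using assms(2) by (intro mult_left_mono) auto
    with C assms(1) show ?thesis by (intro exI[of _ a] exI[of _ C]) (simp add: good_def mult.assoc)
  qed
  then obtain a C where "\<And>n. good n (a n) (C n)" by metis
  then have C: "C n \<subseteq> B \<inter> {a n + 1..a n + int n}"
    and card_C: "\<alpha> * \<beta> * real n \<le> real (card (C n))"
    and BD_C: "BD {u. \<forall>c\<in>C n. u + c \<in> A} > 0" for n
    unfolding good_def by auto
  obtain F N where F: "finite F" "F \<subseteq> X" "x \<in> F" "real (card F) \<le> 1 / (\<alpha> * \<beta>)"
    and N: "infinite N"
    and cover: "\<And>y. y \<in> X \<Longrightarrow> finite {n \<in> N. y \<notin> diff_set (C n) (C n) + F}"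
    by (rule covering_by_few_translates[of C a "\<alpha> * \<beta>" x X]) (use C card_C assms x in auto)
  have "BD {t. \<forall>g\<in>G. t + g \<in> diff_set A B + F} > 0" if G: "finite G" "G \<subseteq> X" for G
  proof -
    have "finite (\<Union>g\<in>G. {n \<in> N. g \<notin> diff_set (C n) (C n) + F})"
      using G cover by blast
    then have "\<not> N \<subseteq> (\<Union>g\<in>G. {n \<in> N. g \<notin> diff_set (C n) (C n) + F})"
      using N finite_subset by blast
    then obtain n where n: "\<And>g. g \<in> G \<Longrightarrow> g \<in> diff_set (C n) (C n) + F" by blast
    have "{u. \<forall>c\<in>C n. u + c \<in> A} \<subseteq> {t. \<forall>g\<in>G. t + g \<in> diff_set A B + F}"
    proof (intro subsetI CollectI ballI)
      fix u g assume u: "u \<in> {u. \<forall>c\<in>C n. u + c \<in> A}" and "g \<in> G"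
      from n[OF \<open>g \<in> G\<close>] obtain c c' f
        where c: "c \<in> C n" "c' \<in> C n" and f: "f \<in> F" and g: "g = (c - c') + f"
        unfolding diff_set_def set_plus_def by blast
      have "(u + c) - c' \<in> diff_set A B" using u c C[of n] unfolding diff_set_def by blast
      moreover have "u + g = ((u + c) - c') + f" using g by simp
      ultimately show "u + g \<in> diff_set A B + F" using f set_plus_intro by metis
    qed
    then show ?thesis by (rule less_le_trans[OF BD_C BD_mono])
  qed
  then have "X \<lhd>\<^sub>d diff_set A B + F" by (simp add: dense_embeddable_def)
  moreover have "F \<subset> X" using F X by blast
  moreover have "int (card F) \<le> \<lfloor>1 / (\<alpha> * \<beta>)\<rfloor>" using F(4) by (simp add: le_floor_iff)
  ultimately show "\<exists>F. finite F \<and> F \<subset> X \<and> x \<in> F \<and> int (card F) \<le> \<lfloor>1 / (\<alpha> * \<beta>)\<rfloor>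
      \<and> X \<lhd>\<^sub>d diff_set A B + F"
    using F by blast
qed

end
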